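(* Let $A\in\mathbb{R}^{m\times n}$ be a full-rank matrix whose rows $a_1^T,\dots,a_m^T$ have unit Euclidean norm, let $\hat x\in\mathbb{R}^n$, $\hat x\ne0$, put $\tilde b=A\hat x$, and let $b=\tilde b+b^c$, where $b^c\in\mathbb{R}^m$ is any vector with $\|b^c\|_0=\beta m$. Let $\lambda>0$ and $\beta<q<1-\beta$. Assume that $$\frac{2q}{q-\beta}\left(\frac{2\sqrt\beta}{\sqrt{1-q-\beta}}+\frac{\beta}{1-q-\beta}\right)\frac{|\hat x|_{\min}+2\lambda}{|\hat x|_{\min}}<\frac{\tilde\sigma_{q-\beta,\min}^2}{\sigma_{\max}^2}.$$ Define $$C=\frac{q-\beta}{2q^2m}\cdot\frac{|\hat x|_{\min}}{|\hat x|_{\min}+2\lambda}\cdot\tilde\sigma_{q-\beta,\min}^2-\frac{1}{qm}\left(\frac{2\sqrt\beta}{\sqrt{1-q-\beta}}+\frac{\beta}{1-q-\beta}\right)\sigma_{\max}^2 .$$ Then $C>0$ and for every $k\ge0$: (a) the iterates generated by Quantile-RaSK with inexact step, run on $(A,b)$, satisfy $$\mathbb{E}\big[D_f^{x_{k+1}^*}(x_{k+1},\hat x)\big]\le(1-C)\,\mathbb{E}\big[D_f^{x_k^*}(x_k,\hat x)\big];$$ (b) the iterates generated by Quantile-RaSK with exact step, run on $(A,b)$, satisfy $$\mathbb{E}\big[D_f^{x_{k+1}^*}(x_{k+1},\hat x)\big]\le(1-C)\,\mathbb{E}\big[D_f^{x_k^*}(x_k,\hat x)\big]+\frac{2\lambda}{qm}\|b-\tilde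 b\|\,\|A\|_{1,2}.$$
   Context: Notation. $\|\cdot\|$ is the Euclidean norm; $\|b^c\|_0$ is the number of nonzero entries; $\|A\|_{1,2}=\sqrt{\sum_{i=1}^m\|a_i\|_1^2}$; $|\hat x|_{\min}=\min\{|\hat x_j|:\hat x_j\ne0\}$. It is assumed that $\beta m$ and $qm$ are integers. For a matrix $M$, $\sigma_{\min}(M)=\min_{x\ne0}\|Mx\|/\|x\|$ and $\sigma_{\max}(M)=\max_{x\neq 0}\|Mx\|/\|x\|$; $\sigma_{\max}=\sigma_{\max}(A)$. With $A_{I,J}$ the submatrix of $A$ with rows indexed by $I$ and columns indexed by $J$, $$\tilde\sigma_{q-\beta,\min}=\min\{\sigma_{\min}(A_{I,J}): I\subset\{1,\dots,m\},\ |I|=(q-\beta)m,\ \emptyset\ne J\subset\{1,\dots,n\}\}.$$ Function and Bregman distance. $f(x)=\lambda\|x\|_1+\frac12\|x\|^2$, with Fenchel conjugate $f^*(x)=\sup_z\{\langle x,z\rangle-f(z)\}$. For $x^*\in\partial f(x)$, $D_f^{x^*}(x,y)=f(y)-f(x)-\langle x^*,y-x\rangle$. The soft shrinkage $\mathcal S_\lambda(x)=\max\{|x|-\lambda,0\}\cdot\mathrm{sign}(x)$ is applied componentwise. Quantile. For reals $y_1,\dots,y_m$ sorted increasingly as $y_{(1)}\le\dots\le y_{(m)}$ and $qm$ an integer, the $q$-quantile is $(y_{(qm)}+y_{(qm+1)})/2$. Quantile-RaSK. Start from $x_0=x_0^*=0$. At step $k$, let $Q_k$ be the $q$-quantile of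 the residuals $|\langle a_i,x_k\rangle-b_i|$, $1\le i\le m$; let $N_2=\{i:|\langle a_i,x_k\rangle-b_i|\le Q_k\}$ (understood to have exactly $qm$ elements); sample $i_k\in N_2$ at random, each element with probability $1/(qm)$ (conditionally on the past); choose $t_k$ by - inexact step: $t_k=\langle a_{i_k},x_k\rangle-b_{i_k}$; - exact step: $t_k\in\arg\min_{t\in\mathbb{R}}\, f^*(x_k^*-t a_{i_k})+t\,b_{i_k}$; and set $x_{k+1}^*=x_k^*-t_k a_{i_k}$, $x_{k+1}=\mathcal S_\lambda(x_{k+1}^* )$ (so $x_k^*\in\partial f(x_k)$). Expectations are over the random indices $i_0,i_1,\dots$. *)

theory Defs
  imports "HOL-Probability.Probability"
begin

definition l1_norm :: "real ^ 'n \<Rightarrow> real" where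
  "l1_norm x = (\<Sum>j\<in>UNIV. \<bar>x $ j\<bar>)"

definition l0_norm :: "real ^ 'n \<Rightarrow> nat" where
  "l0_norm x = card {j. x $ j \<noteq> 0}"

definition norm_1_2 :: "real ^ 'n ^ 'm \<Rightarrow> real" where
  "norm_1_2 A = sqrt (\<Sum>i\<in>UNIV. (l1_norm (row i A))\<^sup>2)"

definition abs_min :: "real ^ 'n \<Rightarrow> real" where
  "abs_min x = Min {\<bar>x $ j\<bar> | j. x $ j \<noteq> 0}"

definition sigma_max :: "real ^ 'n ^ 'm \<Rightarrow> real" where
  "sigma_max A = (SUP x\<in>{x. x \<noteq> 0}. norm (A *v x) / norm x)"

(* The smallest singular value of the submatrix of A with rows I and columns J. A vector of R^J is
   represented by a function on all column indices, of which only the values on J are used. *)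
definition sigma_min_submatrix :: "real ^ 'n ^ 'm \<Rightarrow> 'm set \<Rightarrow> 'n set \<Rightarrow> real" where
  "sigma_min_submatrix A I J =
     (INF x\<in>{x :: 'n \<Rightarrow> real. \<exists>j\<in>J. x j \<noteq> 0}.
        L2_set (\<lambda>i. \<Sum>j\<in>J. A $ i $ j * x j) I / L2_set x J)"

definition sigma_tilde_min :: "real \<Rightarrow> real ^ 'n ^ 'm \<Rightarrow> real" where
  "sigma_tilde_min p A =
     Min {sigma_min_submatrix A I J | I J. real (card I) = p * real CARD('m) \<and> J \<noteq> {}}"

definition objective :: "real \<Rightarrow> real ^ 'n \<Rightarrow> real" where
  "objective lam x = lam * l1_norm x + (norm x)\<^sup>2 / 2"

(* Real-valued, hence only meaningful where the supremum is finite; for the objective with lam > 0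
   this is the case everywhere. *)
definition fenchel_conjugate :: "('a::real_inner \<Rightarrow> real) \<Rightarrow> 'a \<Rightarrow> real" where
  "fenchel_conjugate g x = (SUP z. x \<bullet> z - g z)"

(* Used only for subgradients xs of g at x. *)
definition bregman_dist :: "('a::real_inner \<Rightarrow> real) \<Rightarrow> 'a \<Rightarrow> 'a \<Rightarrow> 'a \<Rightarrow> real" where
  "bregman_dist g xs x y = g y - g x - xs \<bullet> (y - x)"

definition soft_shrinkage :: "real \<Rightarrow> real ^ 'n \<Rightarrow> real ^ 'n" where
  "soft_shrinkage lam x = (\<chi> j. max (\<bar>x $ j\<bar> - lam) 0 * sgn (x $ j))"

(* List positions start at 0, so the r-th smallest value is at position r - 1.
   Used only when q * CARD('m) is an integer with 1 \<le> q * CARD('m) < CARD('m). *)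
definition quantile :: "real \<Rightarrow> ('m::finite \<Rightarrow> real) \<Rightarrow> real" where
  "quantile q y =
     (let ys = sorted_list_of_multiset (image_mset y (mset_set UNIV));
          r = nat \<lfloor>q * real CARD('m)\<rfloor>
      in (ys ! (r - 1) + ys ! r) / 2)"

definition abs_residual :: "real ^ 'n ^ 'm \<Rightarrow> real ^ 'm \<Rightarrow> real ^ 'n \<Rightarrow> 'm \<Rightarrow> real" where
  "abs_residual A b x i = \<bar>row i A \<bullet> x - b $ i\<bar>"

(* If ties at the quantile leave more than q * CARD('m) indices below it, any choice of
   q * CARD('m) of them is allowed. Without such ties the choice is unique. *)
definition admissible_sample_set ::
  "real \<Rightarrow> real ^ 'n ^ 'm \<Rightarrow> real ^ 'm \<Rightarrow> real ^ 'n \<Rightarrow> 'm set \<Rightarrow> bool" where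
  "admissible_sample_set q A b x N \<longleftrightarrow>
     N \<subseteq> {i. abs_residual A b x i \<le> quantile q (abs_residual A b x)} \<and>
     real (card N) = q * real CARD('m)"

definition inexact_step ::
  "real \<Rightarrow> real ^ 'n ^ 'm \<Rightarrow> real ^ 'm \<Rightarrow> real ^ 'n \<Rightarrow> 'm \<Rightarrow> real \<Rightarrow> bool" where
  "inexact_step lam A b xs i t \<longleftrightarrow> t = row i A \<bullet> soft_shrinkage lam xs - b $ i"

definition exact_step ::
  "real \<Rightarrow> real ^ 'n ^ 'm \<Rightarrow> real ^ 'm \<Rightarrow> real ^ 'n \<Rightarrow> 'm \<Rightarrow> real \<Rightarrow> bool" where
  "exact_step lam A b xs i t \<longleftrightarrow>
     is_arg_min (\<lambda>s. fenchel_conjugate (objective lam) (xs - s *\<^sub>R row i A) + s * b $ i)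
       (\<lambda>_. True) t"

(* A history is the list of the indices drawn so far, most recent first. All choices that the
   method leaves open (tie-breaking, selection of a minimiser) may depend on the history. *)
primrec history :: "(nat \<Rightarrow> 'w \<Rightarrow> 'm) \<Rightarrow> nat \<Rightarrow> 'w \<Rightarrow> 'm list" where
  "history idx 0 \<omega> = []"
| "history idx (Suc k) \<omega> = idx k \<omega> # history idx k \<omega>"

primrec dual_iterate :: "real ^ 'n ^ 'm \<Rightarrow> ('m list \<Rightarrow> real) \<Rightarrow> 'm list \<Rightarrow> real ^ 'n" where
  "dual_iterate A t [] = 0"
| "dual_iterate A t (i # h) = dual_iterate A t h - t (i # h) *\<^sub>R row i A"

definition primal_iterate ::
  "real \<Rightarrow> real ^ 'n ^ 'm \<Rightarrow> ('m list \<Rightarrow> real) \<Rightarrow> 'm list \<Rightarrow> real ^ 'n" where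
  "primal_iterate lam A t h = soft_shrinkage lam (dual_iterate A t h)"

(* N h is the set from which the index following the history h is drawn, t (i # h) is the step size
   used when i is drawn after h. The last conjunct says that, conditionally on the history, the next
   index is uniformly distributed on N h. *)
definition quantile_rask ::
  "(real \<Rightarrow> real ^ 'n ^ 'm \<Rightarrow> real ^ 'm \<Rightarrow> real ^ 'n \<Rightarrow> 'm \<Rightarrow> real \<Rightarrow> bool) \<Rightarrow>
   real \<Rightarrow> real \<Rightarrow> real ^ 'n ^ 'm \<Rightarrow> real ^ 'm \<Rightarrow>
   'w measure \<Rightarrow> (nat \<Rightarrow> 'w \<Rightarrow> 'm) \<Rightarrow> ('m list \<Rightarrow> 'm set) \<Rightarrow> ('m list \<Rightarrow> real) \<Rightarrow> bool" where
  "quantile_rask step lam q A b M idx N t \<longleftrightarrow>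
     prob_space M \<and>
     (\<forall>k. idx k \<in> measurable M (count_space UNIV)) \<and>
     (\<forall>h. admissible_sample_set q A b (primal_iterate lam A t h) (N h)) \<and>
     (\<forall>h. \<forall>i\<in>N h. step lam A b (dual_iterate A t h) i (t (i # h))) \<and>
     (\<forall>k h i.
        \<P>(\<omega> in M. history idx k \<omega> = h \<and> idx k \<omega> = i) =
        (if i \<in> N h then 1 / (q * real CARD('m)) else 0) * \<P>(\<omega> in M. history idx k \<omega> = h))"

definition expected_distance ::
  "real \<Rightarrow> real ^ 'n ^ 'm \<Rightarrow> real ^ 'n \<Rightarrow>
   'w measure \<Rightarrow> (nat \<Rightarrow> 'w \<Rightarrow> 'm) \<Rightarrow> ('m list \<Rightarrow> real) \<Rightarrow> nat \<Rightarrow> real" where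
  "expected_distance lam A xhat M idx t k =
     (\<integral>\<omega>. bregman_dist (objective lam) (dual_iterate A t (history idx k \<omega>))
             (primal_iterate lam A t (history idx k \<omega>)) xhat \<partial>M)"

end

theory Submission
  imports Defs
begin

text \<open>Let \<open>D\<close> be the Bregman distance from the current iterate \<open>x = soft_shrinkage lam z\<close> to \<open>y\<close>. The
  conjugate of the objective is 1-smooth with gradient \<open>soft_shrinkage lam\<close>, so an inexact step of size
  \<open>t\<close> along a unit row \<open>a\<close> changes \<open>D\<close> by at most \<open>t\<^sup>2 / 2 - t * (a \<bullet> (x - y))\<close>. On an
  uncorrupted row this is a gain of half the squared residual. On a corrupted row \<open>t\<close> is bounded by the
  quantile, which the uncorrupted rows above the quantile bound in terms of \<open>sigma_max A * norm (x - y)\<close>.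
  The hypothesis makes \<open>sigma_tilde_min\<close> positive, so the uncorrupted sampled rows alone control
  \<open>norm (x - y)\<close>, and \<open>D\<close> is comparable to \<open>(norm (x - y))\<^sup>2\<close>. The exact step size differs from the
  inexact one by at most \<open>2 * lam * l1_norm a\<close>, which yields the additive error term.\<close>

section \<open>Soft shrinkage and two-sided bounds on the Bregman distance\<close>

text \<open>Together the two facts say that \<open>z - soft_shrinkage lam z\<close> is a subgradient
  of \<open>lam * l1_norm\<close> at \<open>soft_shrinkage lam z\<close>. All later arguments about
  the shrinkage go through them.\<close>

lemma soft_shrinkage_component:
  assumes "lam \<ge> 0"
  shows "\<bar>z $ j - soft_shrinkage lam z $ j\<bar> \<le> lam"
    and "(z $ j - soft_shrinkage lam z $ j) * soft_shrinkage lam z $ j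
           = lam * \<bar>soft_shrinkage lam z $ j\<bar>"
  using assms by (auto simp: soft_shrinkage_def max_def abs_if sgn_if algebra_simps)

text \<open>The distance separates over coordinates into a quadratic part and the Bregman distance
  of \<open>lam * l1_norm\<close>. In the latter the terms at \<open>x\<close> cancel by the second
  fact of \<open>soft_shrinkage_component\<close>, so bounds on the distance reduce to
  one-dimensional ones.\<close>

lemma bregman_soft_shrinkage:
  fixes y z :: "real ^ 'n"
  assumes "lam \<ge> 0"
  defines "x \<equiv> soft_shrinkage lam z"
  shows "bregman_dist (objective lam) z x y
         = (\<Sum>j\<in>UNIV. (y $ j - x $ j)\<^sup>2 / 2 + (lam * \<bar>y $ j\<bar> - (z $ j - x $ j) * y $ j))"
proof -
  have "(y $ j - x $ j)\<^sup>2 / 2 + (lam * \<bar>y $ j\<bar> - (z $ j - x $ j) * y $ j)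
      = lam * \<bar>y $ j\<bar> + y $ j * y $ j / 2 - (lam * \<bar>x $ j\<bar> + x $ j * x $ j / 2)
        - z $ j * (y $ j - x $ j)" for j
    using soft_shrinkage_component(2)[OF assms(1), of z j, folded x_def]
    by (simp add: power2_eq_square field_simps)
  then show ?thesis
    by (simp only: bregman_dist_def objective_def l1_norm_def power2_norm_eq_inner inner_vec_def
        sum.distrib sum_subtractf sum_distrib_left sum_divide_distrib inner_real_def
        vector_minus_component)
qed

lemma norm_sq_eq_sum: "(norm (v :: real ^ 'n))\<^sup>2 = (\<Sum>j\<in>UNIV. (v $ j)\<^sup>2)"
  by (subst power2_norm_eq_inner) (simp add: inner_vec_def power2_eq_square)

text \<open>Strong convexity of the objective: each nonsmooth summand is nonnegative, since
  \<open>z $ j - soft_shrinkage lam z $ j\<close> lies between \<open>-lam\<close> and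
  \<open>lam\<close>.\<close>

lemma bregman_soft_shrinkage_lower:
  fixes y z :: "real ^ 'n"
  assumes "lam \<ge> 0"
  shows "(norm (y - soft_shrinkage lam z))\<^sup>2 / 2
         \<le> bregman_dist (objective lam) z (soft_shrinkage lam z) y"
proof -
  have "0 \<le> lam * \<bar>y $ j\<bar> - (z $ j - soft_shrinkage lam z $ j) * y $ j" for j
    using mult_right_mono[OF soft_shrinkage_component(1)[OF assms, of z j], of "\<bar>y $ j\<bar>"]
    by (simp add: abs_mult[symmetric])
  then show ?thesis
    unfolding bregman_soft_shrinkage[OF assms] norm_sq_eq_sum sum_divide_distrib
    by (intro sum_mono) simp
qed

lemma abs_min_le: "y $ j \<noteq> 0 \<Longrightarrow> abs_min y \<le> \<bar>y $ j\<bar>"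
  unfolding abs_min_def by (rule Min_le) auto

lemma abs_min_pos:
  assumes "y \<noteq> (0 :: real ^ 'n)"
  shows "abs_min y > 0"
proof -
  obtain j where "y $ j \<noteq> 0" using assms by (auto simp: vec_eq_iff)
  then have "{\<bar>y $ j\<bar> | j. y $ j \<noteq> 0} \<noteq> {}" by auto
  moreover have "finite {\<bar>y $ j\<bar> | j. y $ j \<noteq> 0}" by simp
  ultimately show ?thesis unfolding abs_min_def by (subst Min_gr_iff) auto
qed

text \<open>A coordinate contributes to the nonsmooth part of the distance only where the signs of
  \<open>y\<close> and of the shrunk vector differ, and there they are at least \<open>abs_min y\<close> apart.\<close>
lemma bregman_soft_shrinkage_upper:
  fixes y z :: "real ^ 'n"
  assumes "lam \<ge> 0" and "y \<noteq> 0"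
  shows "bregman_dist (objective lam) z (soft_shrinkage lam z) y
         \<le> (1 + 2 * lam / abs_min y) * (norm (y - soft_shrinkage lam z))\<^sup>2"
proof -
  define x where "x = soft_shrinkage lam z"
  have pos: "abs_min y > 0" by (rule abs_min_pos) fact
  have "(y $ j - x $ j)\<^sup>2 / 2 + (lam * \<bar>y $ j\<bar> - (z $ j - x $ j) * y $ j)
        \<le> (1 + 2 * lam / abs_min y) * (y $ j - x $ j)\<^sup>2" for j
  proof -
    note c = soft_shrinkage_component[OF assms(1), of z j, folded x_def]
    have "lam * \<bar>y $ j\<bar> - (z $ j - x $ j) * y $ j \<le> 2 * lam / abs_min y * (y $ j - x $ j)\<^sup>2"
    proof (cases "y $ j * x $ j > 0 \<or> y $ j = 0")
      case True
      have "lam * \<bar>y $ j\<bar> - (z $ j - x $ j) * y $ j = 0"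
        using True
      proof
        assume yx: "y $ j * x $ j > 0"
        then have x0: "x $ j \<noteq> 0" by auto
        have "(z $ j - x $ j) * x $ j = (lam * sgn (x $ j)) * x $ j"
          using c(2) by (simp add: abs_sgn mult_ac)
        then have "z $ j - x $ j = lam * sgn (x $ j)" using x0 by simp
        also have "sgn (x $ j) = sgn (y $ j)"
          using yx by (auto simp: zero_less_mult_iff)
        finally show ?thesis by (simp add: sgn_if abs_if)
      qed simp
      then show ?thesis using pos assms(1) by simp
    next
      case False
      have "\<bar>(z $ j - x $ j) * y $ j\<bar> \<le> lam * \<bar>y $ j\<bar>"
        using mult_right_mono[OF c(1), of "\<bar>y $ j\<bar>"] by (simp add: abs_mult)
      then have 1: "lam * \<bar>y $ j\<bar> - (z $ j - x $ j) * y $ j \<le> 2 * lam * \<bar>y $ j\<bar>" by linarith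
      \<comment> \<open>Here \<open>x $ j\<close> is zero or of sign opposite to
        \<open>y $ j\<close>, so the distance between them is at least
        \<open>\<bar>y $ j\<bar>\<close>, hence at least \<open>abs_min y\<close>. The product of
        these two bounds turns the linear term into a quadratic one.\<close>
      have d: "\<bar>y $ j\<bar> \<le> \<bar>y $ j - x $ j\<bar>"
        using False by (auto simp: zero_less_mult_iff)
      have "abs_min y * \<bar>y $ j\<bar> \<le> \<bar>y $ j - x $ j\<bar> * \<bar>y $ j - x $ j\<bar>"
        using abs_min_le[of y j] False d pos by (intro mult_mono) auto
      then have "\<bar>y $ j\<bar> \<le> (y $ j - x $ j)\<^sup>2 / abs_min y"
        using pos by (simp add: field_simps power2_eq_square)
      from mult_left_mono[OF this, of "2 * lam"] 1 assms(1) show ?thesis by simp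
    qed
    \<comment> \<open>The coefficient 1/2 of the quadratic part is relaxed to 1, so that the total
      constant is \<open>(abs_min y + 2 * lam) / abs_min y\<close>, the reciprocal of the factor in
      \<open>C\<close>.\<close>
    moreover have "(y $ j - x $ j)\<^sup>2 \<ge> 0" by simp
    ultimately show ?thesis unfolding ring_distribs by linarith
  qed
  then show ?thesis
    unfolding bregman_soft_shrinkage[OF assms(1)] norm_sq_eq_sum sum_distrib_left x_def
    by (intro sum_mono) simp
qed

section \<open>The conjugate and the descent inequality\<close>

text \<open>The supremum is attained at the shrunk vector, because the gap to the value at any other
  \<open>y\<close> is a Bregman distance and so nonnegative.\<close>

lemma fenchel_conjugate_objective:
  assumes "lam \<ge> 0"
  shows "fenchel_conjugate (objective lam) z
         = z \<bullet> soft_shrinkage lam z - objective lam (soft_shrinkage lam z)"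
proof -
  have "z \<bullet> y - objective lam y \<le> z \<bullet> soft_shrinkage lam z - objective lam (soft_shrinkage lam z)"
    for y
  proof -
    have "0 \<le> bregman_dist (objective lam) z (soft_shrinkage lam z) y"
      using bregman_soft_shrinkage_lower[OF assms, of y z] by (smt (verit) zero_le_power2 divide_nonneg_nonneg)
    then show ?thesis by (simp add: bregman_dist_def inner_diff_right)
  qed
  then show ?thesis unfolding fenchel_conjugate_def by (intro cSup_eq_maximum) auto
qed

text \<open>For fixed \<open>y\<close> the distance depends on \<open>z\<close> through the
  conjugate and a linear term only, so properties of the conjugate and of the distance transfer to
  each other.\<close>

lemma bregman_eq_conjugate:
  assumes "lam \<ge> 0"
  shows "bregman_dist (objective lam) z (soft_shrinkage lam z) y
         = objective lam y - z \<bullet> y + fenchel_conjugate (objective lam) z"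
  by (simp add: bregman_dist_def fenchel_conjugate_objective[OF assms] inner_diff_right)

text \<open>The change of the distance is
  \<open>- bregman_dist (objective lam) z x x' - d \<bullet> (x' - y)\<close>. Strong convexity
  bounds the first term by a square of \<open>x' - x\<close>, and completing the square removes the
  unknown move \<open>x' - x\<close>.\<close>

lemma bregman_descent:
  fixes y z d :: "real ^ 'n"
  assumes "lam \<ge> 0"
  shows "bregman_dist (objective lam) (z - d) (soft_shrinkage lam (z - d)) y
         \<le> bregman_dist (objective lam) z (soft_shrinkage lam z) y
            - d \<bullet> (soft_shrinkage lam z - y) + (norm d)\<^sup>2 / 2"
proof -
  define x where "x = soft_shrinkage lam z"
  define x' where "x' = soft_shrinkage lam (z - d)"
  have 1: "(norm (x' - x))\<^sup>2 / 2 \<le> bregman_dist (objective lam) z x x'"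
    unfolding x_def by (rule bregman_soft_shrinkage_lower[OF assms])
  have 2: "0 \<le> (norm ((x' - x) + d))\<^sup>2" by simp
  show ?thesis
    using 1 2 unfolding x_def[symmetric] x'_def[symmetric] bregman_dist_def power2_norm_eq_inner
    by (simp add: inner_diff_right inner_diff_left inner_add_left inner_add_right inner_commute)
qed

lemma fenchel_conjugate_descent:
  fixes z d :: "real ^ 'n"
  assumes "lam \<ge> 0"
  shows "fenchel_conjugate (objective lam) (z - d)
         \<le> fenchel_conjugate (objective lam) z - d \<bullet> soft_shrinkage lam z + (norm d)\<^sup>2 / 2"
  using bregman_descent[OF assms, of z d 0] by (simp add: bregman_eq_conjugate[OF assms])

section \<open>The exact step compared with the inexact one\<close>

lemma inner_le_l1_norm:
  fixes a v :: "real ^ 'n"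
  assumes "\<And>j. \<bar>v $ j\<bar> \<le> c"
  shows "\<bar>a \<bullet> v\<bar> \<le> c * l1_norm a"
proof -
  have "\<bar>a \<bullet> v\<bar> \<le> (\<Sum>j\<in>UNIV. \<bar>a $ j * v $ j\<bar>)"
    unfolding inner_vec_def by (simp add: sum_abs)
  also have "\<dots> \<le> (\<Sum>j\<in>UNIV. c * \<bar>a $ j\<bar>)"
  proof (rule sum_mono)
    fix j show "\<bar>a $ j * v $ j\<bar> \<le> c * \<bar>a $ j\<bar>"
      using mult_left_mono[OF assms[of j], of "\<bar>a $ j\<bar>"] by (simp add: abs_mult mult.commute)
  qed
  finally show ?thesis by (simp add: l1_norm_def sum_distrib_left)
qed

text \<open>The minimiser is compared with the gradient step of length 1 from it: by 1-smoothness a nonzero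
  derivative would give a decrease.\<close>
lemma exact_step_equation:
  fixes A :: "real ^ 'n ^ 'm"
  assumes "lam \<ge> 0" and "norm (row i A) = 1" and "exact_step lam A b z i t"
  shows "row i A \<bullet> soft_shrinkage lam (z - t *\<^sub>R row i A) = b $ i"
proof -
  define a where "a = row i A"
  define w where "w = z - t *\<^sub>R a"
  \<comment> \<open>\<open>c\<close> is minus the derivative of the minimised function at
    \<open>t\<close>, so \<open>t + c\<close> is the gradient step.\<close>
  define c where "c = a \<bullet> soft_shrinkage lam w - b $ i"
  have eq: "z - (t + c) *\<^sub>R a = w - c *\<^sub>R a" by (simp add: w_def algebra_simps)
  have "fenchel_conjugate (objective lam) w + t * b $ i
        \<le> fenchel_conjugate (objective lam) (w - c *\<^sub>R a) + (t + c) * b $ i"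
    using assms(3) unfolding exact_step_def is_arg_min_linorder a_def[symmetric] w_def[symmetric] eq[symmetric]
    by blast
  also have "\<dots> \<le> fenchel_conjugate (objective lam) w - c * (a \<bullet> soft_shrinkage lam w) + c\<^sup>2 / 2
                  + (t + c) * b $ i"
    using fenchel_conjugate_descent[OF assms(1), of w "c *\<^sub>R a"] assms(2)
    by (simp add: a_def power_mult_distrib)
  also have "\<dots> = fenchel_conjugate (objective lam) w + t * b $ i - c\<^sup>2 / 2"
    by (simp add: c_def power2_eq_square field_simps)
  finally have "c\<^sup>2 \<le> 0" by simp
  then have "c = 0" by simp
  then show ?thesis by (simp add: c_def w_def a_def)
qed

text \<open>The exact step solves the row equation at the shrunk \<open>w\<close>, so
  \<open>s\<close> is the inner product of \<open>a\<close> with the difference of the shrunk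
  \<open>z\<close> and \<open>w\<close>, while \<open>t\<close> is that with \<open>z - w\<close>
  itself. Shrinkage moves each coordinate by at most \<open>lam\<close>, once for \<open>z\<close>
  and once for \<open>w\<close>.\<close>

lemma exact_step_close_to_inexact:
  fixes A :: "real ^ 'n ^ 'm"
  assumes "lam \<ge> 0" and "norm (row i A) = 1" and "exact_step lam A b z i t"
    and "inexact_step lam A b z i s"
  shows "\<bar>s - t\<bar> \<le> 2 * lam * l1_norm (row i A)"
proof -
  define a where "a = row i A"
  define w where "w = z - t *\<^sub>R a"
  have aa: "a \<bullet> a = 1" using assms(2) by (simp add: a_def norm_eq_1)
  have b: "b $ i = a \<bullet> soft_shrinkage lam w"
    using exact_step_equation[OF assms(1-3)] by (simp add: a_def w_def)
  have "s - t = a \<bullet> (w - soft_shrinkage lam w) - a \<bullet> (z - soft_shrinkage lam z)"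
    using assms(4) aa unfolding inexact_step_def
    by (simp add: a_def[symmetric] b inner_diff_right w_def)
  moreover have "\<bar>a \<bullet> (v - soft_shrinkage lam v)\<bar> \<le> lam * l1_norm a" for v
    by (rule inner_le_l1_norm) (simp add: soft_shrinkage_component(1)[OF assms(1)])
  note this[of w] this[of z]
  ultimately show ?thesis unfolding a_def[symmetric] by linarith
qed

text \<open>Minimality of \<open>t\<close> controls the conjugates. What remains is
  \<open>s - t\<close> times the corruption of the row, which vanishes on uncorrupted rows.\<close>

lemma bregman_exact_le_inexact:
  fixes A :: "real ^ 'n ^ 'm" and y :: "real ^ 'n"
  assumes "lam \<ge> 0" and "norm (row i A) = 1" and "exact_step lam A b z i t"
    and "inexact_step lam A b z i s"
  defines "D \<equiv> \<lambda>z. bregman_dist (objective lam) z (soft_shrinkage lam z) y"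
  shows "D (z - t *\<^sub>R row i A)
         \<le> D (z - s *\<^sub>R row i A) + 2 * lam * (l1_norm (row i A) * \<bar>b $ i - row i A \<bullet> y\<bar>)"
proof -
  have "fenchel_conjugate (objective lam) (z - t *\<^sub>R row i A) + t * b $ i
        \<le> fenchel_conjugate (objective lam) (z - s *\<^sub>R row i A) + s * b $ i"
    using assms(3) unfolding exact_step_def is_arg_min_linorder by blast
  then have "D (z - t *\<^sub>R row i A)
        \<le> D (z - s *\<^sub>R row i A) + (s - t) * (b $ i - row i A \<bullet> y)"
    unfolding D_def bregman_eq_conjugate[OF assms(1)]
    by (simp add: inner_diff_left algebra_simps)
  also have "(s - t) * (b $ i - row i A \<bullet> y) \<le> \<bar>s - t\<bar> * \<bar>b $ i - row i A \<bullet> y\<bar>"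
    by (metis abs_ge_self abs_mult)
  also have "\<dots> \<le> 2 * lam * l1_norm (row i A) * \<bar>b $ i - row i A \<bullet> y\<bar>"
    by (intro mult_right_mono exact_step_close_to_inexact[OF assms(1-4)]) simp
  finally show ?thesis by (simp add: algebra_simps)
qed

section \<open>Counting values above the quantile\<close>

text \<open>The quantile averages the sorted entries at positions \<open>r - 1\<close> and
  \<open>r\<close>, counted from 0. Hence it does not exceed the latter, nor any of the
  \<open>CARD('m) - r\<close> entries from there on.\<close>

lemma card_ge_quantile:
  fixes y :: "'m::finite \<Rightarrow> real"
  assumes "real r = q * real CARD('m)" and "0 < r" and "r < CARD('m)"
  shows "CARD('m) - r \<le> card {i. quantile q y \<le> y i}"
proof -
  define ys where "ys = sorted_list_of_multiset (image_mset y (mset_set UNIV))"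
  have ms: "mset ys = image_mset y (mset_set UNIV)" by (simp add: ys_def)
  have sorted: "sorted ys" by (simp add: ys_def)
  have len: "length ys = CARD('m)" by (metis ms size_image_mset size_mset size_mset_set)
  have "nat \<lfloor>q * real CARD('m)\<rfloor> = r" by (simp flip: assms(1))
  then have "quantile q y = (ys ! (r - 1) + ys ! r) / 2"
    by (simp add: quantile_def Let_def ys_def)
  moreover have "ys ! (r - 1) \<le> ys ! r"
    using sorted assms(3) len by (intro sorted_nth_mono) auto
  ultimately have Q: "quantile q y \<le> ys ! r" by simp
  have "filter (\<lambda>v. quantile q y \<le> v) (drop r ys) = drop r ys"
  proof (rule filter_True, rule ballI)
    fix v assume "v \<in> set (drop r ys)"
    then obtain j where "j < length ys - r" "v = ys ! (r + j)"
      by (auto simp: in_set_conv_nth)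
    then have "ys ! r \<le> v" using sorted by (auto intro!: sorted_nth_mono)
    then show "quantile q y \<le> v" using Q by simp
  qed
  then have "CARD('m) - r \<le> length (filter (\<lambda>v. quantile q y \<le> v) ys)"
    by (subst append_take_drop_id[of r ys, symmetric], subst filter_append) (simp add: len)
  also have "\<dots> = size (filter_mset (\<lambda>v. quantile q y \<le> v) (image_mset y (mset_set UNIV)))"
    by (metis ms mset_filter size_mset)
  also have "\<dots> = card {i. quantile q y \<le> y i}"
    by (simp add: filter_mset_image_mset)
  finally show ?thesis .
qed

section \<open>Extremal singular values\<close>

lemma matrix_vector_le_sigma_max:
  fixes A :: "real ^ 'n ^ 'm"
  shows "norm (A *v v) \<le> sigma_max A * norm v"
proof (cases "v = 0")
  case False
  have lin: "bounded_linear ((*v) A)" by (rule matrix_vector_mul_bounded_linear)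
  have "norm (A *v v) / norm v \<le> sigma_max A"
    unfolding sigma_max_def
  proof (rule cSUP_upper)
    show "bdd_above ((\<lambda>x. norm (A *v x) / norm x) ` {x. x \<noteq> 0})"
      by (rule bdd_aboveI2[where M = "onorm ((*v) A)"]) (rule le_onorm[OF lin])
  qed (use False in simp)
  then show ?thesis using False by (simp add: field_simps)
qed simp

lemma sigma_max_nonneg: "sigma_max (A :: real ^ 'n ^ 'm) \<ge> 0"
proof -
  obtain v :: "real ^ 'n" where "norm v = 1" using vector_choose_size[of 1] by auto
  then show ?thesis
    using matrix_vector_le_sigma_max[of A v] norm_ge_zero[of "A *v v"] by (simp del: norm_ge_zero)
qed

lemma finite_sigma_tilde_set:
  fixes A :: "real ^ 'n ^ 'm"
  shows "finite {sigma_min_submatrix A I J | I J. real (card I) = p * real CARD('m) \<and> J \<noteq> {}}"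
  by (rule finite_subset[of _ "(\<lambda>(I, J). sigma_min_submatrix A I J) ` UNIV"]) auto

lemma sigma_min_submatrix_nonneg:
  assumes "J \<noteq> {}"
  shows "sigma_min_submatrix A I J \<ge> 0"
proof -
  \<comment> \<open>A witness that the infimum runs over a nonempty set.\<close>
  have "(\<lambda>_. 1 :: real) \<in> {x. \<exists>j\<in>J. x j \<noteq> 0}" using assms by auto
  then show ?thesis unfolding sigma_min_submatrix_def
    by (intro cINF_greatest) (auto simp: L2_set_nonneg)
qed

text \<open>The set \<open>I\<close> guarantees that the minimum is taken over a nonempty
  family.\<close>

lemma sigma_tilde_min_nonneg:
  fixes A :: "real ^ 'n ^ 'm"
  assumes "real (card (I :: 'm set)) = p * real CARD('m)"
  shows "sigma_tilde_min p A \<ge> 0"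
  unfolding sigma_tilde_min_def
  by (subst Min_ge_iff[OF finite_sigma_tilde_set])
     (use assms in \<open>auto intro!: sigma_min_submatrix_nonneg\<close>)

text \<open>The choice \<open>J = UNIV\<close> bounds the minimum by the quotient of norms at
  \<open>v\<close>; nonnegativity permits squaring.\<close>

lemma sigma_tilde_min_le:
  fixes A :: "real ^ 'n ^ 'm"
  assumes I: "real (card I) = p * real CARD('m)"
  shows "(sigma_tilde_min p A)\<^sup>2 * (norm v)\<^sup>2 \<le> (\<Sum>i\<in>I. (row i A \<bullet> v)\<^sup>2)"
proof (cases "v = 0")
  case False
  have "sigma_tilde_min p A \<le> sigma_min_submatrix A I UNIV"
    unfolding sigma_tilde_min_def
    by (rule Min_le[OF finite_sigma_tilde_set]) (use I in blast)
  also have "\<dots> \<le> L2_set (\<lambda>i. \<Sum>j\<in>UNIV. A $ i $ j * v $ j) I / L2_set (($) v) UNIV"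
    unfolding sigma_min_submatrix_def
  proof (rule cINF_lower)
    show "bdd_below ((\<lambda>x. L2_set (\<lambda>i. \<Sum>j\<in>UNIV. A $ i $ j * x j) I / L2_set x UNIV)
            ` {x. \<exists>j\<in>UNIV. x j \<noteq> 0})"
      by (rule bdd_belowI2[where m = 0]) (simp add: L2_set_nonneg)
  qed (use False in \<open>simp add: vec_eq_iff\<close>)
  also have "\<dots> = L2_set (\<lambda>i. row i A \<bullet> v) I / norm v"
    by (simp add: row_def inner_vec_def norm_vec_def L2_set_def)
  finally have "sigma_tilde_min p A * norm v \<le> L2_set (\<lambda>i. row i A \<bullet> v) I"
    using False by (simp add: field_simps)
  then have "(sigma_tilde_min p A * norm v)\<^sup>2 \<le> (L2_set (\<lambda>i. row i A \<bullet> v) I)\<^sup>2"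
    using sigma_tilde_min_nonneg[OF I, of A] by (intro power_mono) auto
  then show ?thesis by (simp add: power_mult_distrib L2_set_def sum_nonneg)
qed (simp add: sum_nonneg)


section \<open>Effects of corrupted and uncorrupted rows\<close>

text \<open>A Markov-type count: of the indices at or above the quantile at most
  \<open>card B\<close> lie in \<open>B\<close>, and each of the others contributes at least the
  squared quantile to the sum.\<close>

lemma quantile_sq_le:
  fixes y e :: "'m::finite \<Rightarrow> real"
  assumes r: "real r = q * real CARD('m)" "0 < r" "r < CARD('m)"
    and y: "\<And>i. i \<notin> B \<Longrightarrow> y i = \<bar>e i\<bar>" and nonneg: "0 \<le> quantile q y"
  shows "(real CARD('m) - real r - real (card B)) * (quantile q y)\<^sup>2 \<le> (\<Sum>i\<in>UNIV. (e i)\<^sup>2)"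
proof -
  define S where "S = {i. quantile q y \<le> y i} - B"
  have "card {i. quantile q y \<le> y i} \<le> card S + card B"
    unfolding S_def by (metis card_Un_le card_mono finite le_trans Un_Diff_cancel2 Un_upper1)
  with card_ge_quantile[OF r, of y] r(3)
  have "real CARD('m) - real r - real (card B) \<le> real (card S)" by linarith
  then have "(real CARD('m) - real r - real (card B)) * (quantile q y)\<^sup>2
             \<le> real (card S) * (quantile q y)\<^sup>2"
    by (rule mult_right_mono) simp
  also have "\<dots> = (\<Sum>i\<in>S. (quantile q y)\<^sup>2)" by simp
  also have "\<dots> \<le> (\<Sum>i\<in>S. (e i)\<^sup>2)"
  proof (rule sum_mono)
    fix i assume "i \<in> S"
    then have "quantile q y \<le> \<bar>e i\<bar>" using y[of i] by (auto simp: S_def)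
    then show "(quantile q y)\<^sup>2 \<le> (e i)\<^sup>2"
      using nonneg power_mono[of "quantile q y" "\<bar>e i\<bar>" 2] by simp
  qed
  also have "\<dots> \<le> (\<Sum>i\<in>UNIV. (e i)\<^sup>2)" by (rule sum_mono2) auto
  finally show ?thesis .
qed

lemma norm_matrix_vector_sq:
  fixes A :: "real ^ 'n ^ 'm"
  shows "(norm (A *v v))\<^sup>2 = (\<Sum>i\<in>UNIV. (row i A \<bullet> v)\<^sup>2)"
  by (simp add: norm_sq_eq_sum matrix_vector_mul_component row_def)

text \<open>The quadratic terms use the bound on \<open>Q\<close> from \<open>quantile_sq_le\<close>
  and give \<open>\<beta> / (1 - q - \<beta>)\<close>. The linear terms use it together with
  Cauchy-Schwarz and give the part with square roots.\<close>

lemma corrupted_rows_bound: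
  fixes A :: "real ^ 'n ^ 'm" and b :: "real ^ 'm" and x y :: "real ^ 'n"
    and q :: real
  defines "B \<equiv> {i. b $ i \<noteq> row i A \<bullet> y}"
    and "Q \<equiv> quantile q (abs_residual A b x)"
  assumes B: "real (card B) = \<beta> * real CARD('m)"
    and qm: "real r = q * real CARD('m)" "0 < q" and q: "q < 1 - \<beta>"
    and nonneg: "0 \<le> Q"
  shows "(\<Sum>i\<in>B. Q\<^sup>2 / 2 + Q * \<bar>row i A \<bullet> (x - y)\<bar>)
         \<le> (2 * sqrt \<beta> / sqrt (1 - q - \<beta>) + \<beta> / (1 - q - \<beta>)) / 2
            * ((sigma_max A)\<^sup>2 * (norm (x - y))\<^sup>2)"
proof -
  define e where "e i = row i A \<bullet> (x - y)" for i
  define m where "m = real CARD('m)"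
  define R where "R = sigma_max A * norm (x - y)"
  define p where "p = 1 - q - \<beta>"
  have m: "m > 0" by (simp add: m_def)
  have p: "p > 0" using q by (simp add: p_def)
  have "0 \<le> \<beta> * m" using B unfolding m_def by (metis of_nat_0_le_iff)
  then have \<beta>: "0 \<le> \<beta>" using m by (simp add: zero_le_mult_iff)
  have R: "0 \<le> R" by (simp add: R_def sigma_max_nonneg)
  have eR: "(\<Sum>i\<in>UNIV. (e i)\<^sup>2) \<le> R\<^sup>2"
    unfolding e_def norm_matrix_vector_sq[symmetric] R_def
    by (intro power_mono matrix_vector_le_sigma_max) simp
  have r: "0 < r" "r < CARD('m)"
  proof -
    have "real r > 0" using qm by simp
    then show "0 < r" by simp
    have "q * m < 1 * m" using q \<beta> m by (intro mult_strict_right_mono) auto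
    then have "real r < real CARD('m)" using qm(1) by (simp add: m_def)
    then show "r < CARD('m)" by simp
  qed
  have "(m - real r - real (card B)) * Q\<^sup>2 \<le> (\<Sum>i\<in>UNIV. (e i)\<^sup>2)"
    unfolding Q_def m_def
    by (rule quantile_sq_le[OF qm(1) r _ nonneg[unfolded Q_def]])
       (auto simp: B_def abs_residual_def e_def inner_diff_right)
  with eR have "p * m * Q\<^sup>2 \<le> R\<^sup>2"
    by (simp add: qm B p_def m_def algebra_simps)
  then have Q2: "m * Q\<^sup>2 \<le> R\<^sup>2 / p" using p by (simp add: field_simps)
  then have "sqrt (m * Q\<^sup>2) \<le> sqrt (R\<^sup>2 / p)" by simp
  then have Q1: "sqrt m * Q \<le> R / sqrt p"
    using nonneg R by (simp add: real_sqrt_mult real_sqrt_divide)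
  \<comment> \<open>Cauchy-Schwarz against the constant 1 yields the factor
    \<open>sqrt (card B)\<close>, that is \<open>sqrt \<beta> * sqrt m\<close>.\<close>
  have "(\<Sum>i\<in>B. \<bar>e i\<bar>) \<le> L2_set (\<lambda>_. 1) B * L2_set e B"
    using L2_set_mult_ineq[of "\<lambda>_. 1" e B] by simp
  also have "\<dots> \<le> (sqrt \<beta> * sqrt m) * R"
  proof (rule mult_mono)
    show "L2_set (\<lambda>_. 1) B \<le> sqrt \<beta> * sqrt m"
      using B by (simp add: L2_set_def m_def real_sqrt_mult)
    have "(\<Sum>i\<in>B. (e i)\<^sup>2) \<le> (\<Sum>i\<in>UNIV. (e i)\<^sup>2)" by (rule sum_mono2) auto
    with eR have "sqrt (\<Sum>i\<in>B. (e i)\<^sup>2) \<le> sqrt (R\<^sup>2)"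
      by (intro real_sqrt_le_mono) linarith
    then show "L2_set e B \<le> R" using R by (simp add: L2_set_def)
  qed (use \<beta> m in \<open>auto simp: L2_set_nonneg\<close>)
  finally have "Q * (\<Sum>i\<in>B. \<bar>e i\<bar>) \<le> Q * (sqrt \<beta> * sqrt m * R)"
    by (rule mult_left_mono[OF _ nonneg])
  \<comment> \<open>Pairing \<open>sqrt m\<close> with \<open>Q\<close> makes the bound independent
    of \<open>m\<close>.\<close>
  also have "\<dots> = sqrt \<beta> * R * (sqrt m * Q)" by simp
  also have "\<dots> \<le> sqrt \<beta> * R * (R / sqrt p)"
    using \<beta> R by (intro mult_left_mono Q1) auto
  finally have 1: "Q * (\<Sum>i\<in>B. \<bar>e i\<bar>) \<le> sqrt \<beta> / sqrt p * R\<^sup>2"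
    by (simp add: power2_eq_square)
  have 2: "\<beta> / 2 * (m * Q\<^sup>2) \<le> \<beta> / 2 * (R\<^sup>2 / p)"
    using \<beta> by (intro mult_left_mono Q2) auto
  have "(\<Sum>i\<in>B. Q\<^sup>2 / 2 + Q * \<bar>e i\<bar>) = \<beta> / 2 * (m * Q\<^sup>2) + Q * (\<Sum>i\<in>B. \<bar>e i\<bar>)"
    by (simp add: sum.distrib sum_distrib_left B m_def)
  also have "\<dots> \<le> \<beta> / 2 * (R\<^sup>2 / p) + sqrt \<beta> / sqrt p * R\<^sup>2"
    by (rule add_mono[OF 2 1])
  also have "\<dots> = (2 * sqrt \<beta> / sqrt p + \<beta> / p) / 2 * R\<^sup>2" by (simp add: algebra_simps)
  finally show ?thesis by (simp add: e_def R_def p_def power_mult_distrib)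
qed

text \<open>At least \<open>(q - \<beta>) * CARD('m)\<close> sampled rows are uncorrupted. Exactly
  that many are selected, as \<open>sigma_tilde_min\<close> prescribes the number of rows, and the
  others only add squares.\<close>

lemma uncorrupted_rows_bound:
  fixes A :: "real ^ 'n ^ 'm" and B N :: "'m set"
  assumes B: "real (card B) = \<beta> * real CARD('m)" and N: "real (card N) = q * real CARD('m)"
    and "\<beta> \<le> q"
  shows "(sigma_tilde_min (q - \<beta>) A)\<^sup>2 * (norm v)\<^sup>2 \<le> (\<Sum>i\<in>N - B. (row i A \<bullet> v)\<^sup>2)"
proof -
  have "card N - card B \<le> card (N - B)" by (rule diff_card_le_card_Diff) simp
  then obtain I where I: "I \<subseteq> N - B" "card I = card N - card B"
    by (meson obtain_subset_with_card_n)
  \<comment> \<open>Ensures that the subtraction of cardinalities is not truncated at zero.\<close>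
  have "real (card B) \<le> real (card N)"
    unfolding B N by (intro mult_right_mono) (use assms(3) in auto)
  then have "card B \<le> card N" by simp
  then have "real (card I) = (q - \<beta>) * real CARD('m)"
    using I(2) B N by (simp add: of_nat_diff left_diff_distrib)
  from sigma_tilde_min_le[OF this]
  have "(sigma_tilde_min (q - \<beta>) A)\<^sup>2 * (norm v)\<^sup>2 \<le> (\<Sum>i\<in>I. (row i A \<bullet> v)\<^sup>2)" .
  also have "\<dots> \<le> (\<Sum>i\<in>N - B. (row i A \<bullet> v)\<^sup>2)"
    using I(1) by (intro sum_mono2) auto
  finally show ?thesis .
qed

section \<open>Contraction in a single step, summed over the sample set\<close>

lemma inexact_step_descent:
  fixes A :: "real ^ 'n ^ 'm" and b :: "real ^ 'm" and y z :: "real ^ 'n"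
    and lam :: real
  defines "x \<equiv> soft_shrinkage lam z"
    and "D \<equiv> \<lambda>z. bregman_dist (objective lam) z (soft_shrinkage lam z) y"
  assumes lam: "lam \<ge> 0" and unit: "\<And>i. norm (row i A) = 1"
    and B: "real (card {i. b $ i \<noteq> row i A \<bullet> y}) = \<beta> * real CARD('m)"
    and q: "0 < q" "\<beta> \<le> q" "q < 1 - \<beta>"
    and adm: "admissible_sample_set q A b x N"
    and t: "\<And>i. i \<in> N \<Longrightarrow> inexact_step lam A b z i (t i)"
  shows "(\<Sum>i\<in>N. D (z - t i *\<^sub>R row i A))
         \<le> q * real CARD('m) * D z
            - (sigma_tilde_min (q - \<beta>) A)\<^sup>2 * (norm (y - x))\<^sup>2 / 2
            + (2 * sqrt \<beta> / sqrt (1 - q - \<beta>) + \<beta> / (1 - q - \<beta>)) / 2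
               * ((sigma_max A)\<^sup>2 * (norm (y - x))\<^sup>2)"
proof -
  define B where "B = {i. b $ i \<noteq> row i A \<bullet> y}"
  define Q where "Q = quantile q (abs_residual A b x)"
  define e where "e i = row i A \<bullet> (x - y)" for i
  have N: "real (card N) = q * real CARD('m)"
    using adm by (simp add: admissible_sample_set_def)
  have t_eq: "t i = row i A \<bullet> x - b $ i" if "i \<in> N" for i
    using t[OF that] by (simp add: inexact_step_def x_def)
  have tQ: "\<bar>t i\<bar> \<le> Q" if "i \<in> N" for i
    using adm that unfolding admissible_sample_set_def abs_residual_def Q_def t_eq[OF that]
    by blast
  \<comment> \<open>Some sampled index exists, and its residual bounds the quantile below by a
    nonnegative number.\<close>
  have "N \<noteq> {}" using N q(1) by auto
  then have Q: "0 \<le> Q" using tQ by (meson abs_ge_zero all_not_in_conv order_trans)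
  have step: "D (z - t i *\<^sub>R row i A) \<le> D z - t i * e i + (t i)\<^sup>2 / 2" for i
    using bregman_descent[OF lam, of z "t i *\<^sub>R row i A" y] unit
    by (simp add: D_def e_def x_def power_mult_distrib)
  have good: "D (z - t i *\<^sub>R row i A) \<le> D z - (e i)\<^sup>2 / 2" if "i \<in> N - B" for i
  proof -
    have "t i = e i" using that t_eq by (simp add: B_def e_def inner_diff_right)
    then show ?thesis using step[of i] by (simp add: power2_eq_square)
  qed
  have bad: "D (z - t i *\<^sub>R row i A) \<le> D z + (Q\<^sup>2 / 2 + Q * \<bar>e i\<bar>)" if "i \<in> N \<inter> B" for i
  proof -
    have "(t i)\<^sup>2 \<le> Q\<^sup>2" using tQ[of i] that by (simp add: abs_le_square_iff[symmetric] Q)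
    moreover have "\<bar>t i * e i\<bar> \<le> Q * \<bar>e i\<bar>"
      using tQ[of i] that by (simp add: abs_mult mult_right_mono)
    ultimately show ?thesis using step[of i] by linarith
  qed
  have "(\<Sum>i\<in>N. D (z - t i *\<^sub>R row i A))
        = (\<Sum>i\<in>N - B. D (z - t i *\<^sub>R row i A)) + (\<Sum>i\<in>N \<inter> B. D (z - t i *\<^sub>R row i A))"
    by (subst sum.Int_Diff[of N _ B]) auto
  also have "\<dots> \<le> (\<Sum>i\<in>N - B. D z - (e i)\<^sup>2 / 2)
                  + (\<Sum>i\<in>N \<inter> B. D z + (Q\<^sup>2 / 2 + Q * \<bar>e i\<bar>))"
    by (intro add_mono sum_mono good bad)
  also have "\<dots> = (\<Sum>i\<in>N. D z) - (\<Sum>i\<in>N - B. (e i)\<^sup>2) / 2 + (\<Sum>i\<in>N \<inter> B. Q\<^sup>2 / 2 + Q * \<bar>e i\<bar>)"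
    by (subst sum.Int_Diff[of N _ B])
       (simp_all only: sum.distrib sum_subtractf sum_divide_distrib finite)
  also have "(\<Sum>i\<in>N. D z) = q * real CARD('m) * D z" by (simp add: N)
  also have "(\<Sum>i\<in>N \<inter> B. Q\<^sup>2 / 2 + Q * \<bar>e i\<bar>) \<le> (\<Sum>i\<in>B. Q\<^sup>2 / 2 + Q * \<bar>e i\<bar>)"
    using Q by (intro sum_mono2) auto
  also have "\<dots> \<le> (2 * sqrt \<beta> / sqrt (1 - q - \<beta>) + \<beta> / (1 - q - \<beta>)) / 2
               * ((sigma_max A)\<^sup>2 * (norm (x - y))\<^sup>2)"
    using corrupted_rows_bound[OF B N q(1,3)] Q by (simp add: Q_def B_def e_def)
  finally show ?thesis
    using uncorrupted_rows_bound[OF B N q(2), of A "x - y"]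
    by (simp add: norm_minus_commute e_def B_def)
qed

text \<open>Passes from the error \<open>norm (y - x)\<close> to the Bregman distance: the upper bound of the latter is
  used on the gain from the uncorrupted rows, the lower bound on the loss from the corrupted ones.\<close>
lemma inexact_step_contraction:
  fixes A :: "real ^ 'n ^ 'm" and b :: "real ^ 'm" and y z :: "real ^ 'n"
    and lam :: real
  defines "D \<equiv> \<lambda>z. bregman_dist (objective lam) z (soft_shrinkage lam z) y"
  assumes lam: "lam \<ge> 0" and unit: "\<And>i. norm (row i A) = 1" and y: "y \<noteq> 0"
    and B: "real (card {i. b $ i \<noteq> row i A \<bullet> y}) = \<beta> * real CARD('m)"
    and q: "0 < q" "\<beta> \<le> q" "q < 1 - \<beta>"
    and adm: "admissible_sample_set q A b (soft_shrinkage lam z) N"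
    and t: "\<And>i. i \<in> N \<Longrightarrow> inexact_step lam A b z i (t i)"
    and C: "C = (q - \<beta>) / (2 * q\<^sup>2 * real CARD('m)) * (abs_min y / (abs_min y + 2 * lam))
               * (sigma_tilde_min (q - \<beta>) A)\<^sup>2
             - 1 / (q * real CARD('m))
               * (2 * sqrt \<beta> / sqrt (1 - q - \<beta>) + \<beta> / (1 - q - \<beta>)) * (sigma_max A)\<^sup>2"
  shows "(\<Sum>i\<in>N. D (z - t i *\<^sub>R row i A)) \<le> q * real CARD('m) * ((1 - C) * D z)"
proof -
  define m where "m = real CARD('m)"
  define S where "S = (sigma_tilde_min (q - \<beta>) A)\<^sup>2"
  define K where "K = (2 * sqrt \<beta> / sqrt (1 - q - \<beta>) + \<beta> / (1 - q - \<beta>)) * (sigma_max A)\<^sup>2"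
  define g where "g = abs_min y / (abs_min y + 2 * lam)"
  define w where "w = (norm (y - soft_shrinkage lam z))\<^sup>2"
  have m: "m > 0" by (simp add: m_def)
  have "0 \<le> \<beta> * m" using B unfolding m_def by (metis of_nat_0_le_iff)
  then have \<beta>: "0 \<le> \<beta>" using m by (simp add: zero_le_mult_iff)
  have K: "0 \<le> K" unfolding K_def using \<beta> q by simp
  have S: "0 \<le> S" by (simp add: S_def)
  have w: "0 \<le> w" by (simp add: w_def)
  have pos: "abs_min y > 0" by (rule abs_min_pos) fact
  have lower: "w / 2 \<le> D z"
    unfolding w_def D_def by (rule bregman_soft_shrinkage_lower[OF lam])
  have "D z \<le> (1 + 2 * lam / abs_min y) * w"
    unfolding w_def D_def by (rule bregman_soft_shrinkage_upper[OF lam y])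
  then have upper: "g * D z \<le> w"
    using pos lam by (simp add: g_def field_simps)
  \<comment> \<open>The factor \<open>(q - \<beta>) / q\<close>, which is at most 1, is inserted to
    match the constant \<open>C\<close>.\<close>
  have "S / 2 * ((q - \<beta>) / q * (g * D z)) \<le> S / 2 * w"
  proof (intro mult_left_mono)
    have "(q - \<beta>) / q * (g * D z) \<le> (q - \<beta>) / q * w"
      using upper q by (intro mult_left_mono) auto
    also have "\<dots> \<le> 1 * w" using q \<beta> w by (intro mult_right_mono) auto
    finally show "(q - \<beta>) / q * (g * D z) \<le> w" by simp
  qed (use S in simp)
  moreover have "K * (w / 2) \<le> K * D z" using K by (intro mult_left_mono lower)
  moreover have "(\<Sum>i\<in>N. D (z - t i *\<^sub>R row i A)) \<le> q * m * D z - S * w / 2 + K / 2 * w"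
    using inexact_step_descent[OF lam unit B q adm t]
    by (simp add: D_def m_def S_def w_def K_def mult_ac)
  moreover have "q * m * ((1 - C) * D z)
      = q * m * D z - S / 2 * ((q - \<beta>) / q * (g * D z)) + K * D z"
  proof -
    have "q * m * C = S / 2 * ((q - \<beta>) / q) * g - K"
    proof -
      have C': "C = (q - \<beta>) / (2 * q\<^sup>2 * m) * g * S - 1 / (q * m) * K"
        unfolding C m_def g_def S_def K_def by (simp only: mult.assoc)
      show ?thesis unfolding C' using m q by (simp add: field_simps power2_eq_square)
    qed
    then have "q * m * (C * D z) = (S / 2 * ((q - \<beta>) / q) * g - K) * D z"
      by (metis mult.assoc)
    moreover define \<rho> where "\<rho> = (q - \<beta>) / q"
    ultimately have "q * m * (C * D z) = (S / 2 * \<rho> * g - K) * D z" by simp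
    then show ?thesis unfolding \<rho>_def[symmetric] by (simp add: algebra_simps)
  qed
  ultimately show ?thesis by (simp add: m_def)
qed

text \<open>Cauchy-Schwarz over the rows; with \<open>v\<close> the corruption, it bounds the total
  excess of the exact steps.\<close>

lemma sum_l1_norm_rows_le:
  fixes A :: "real ^ 'n ^ 'm" and v :: "real ^ 'm"
  shows "(\<Sum>i\<in>N. l1_norm (row i A) * \<bar>v $ i\<bar>) \<le> norm v * norm_1_2 A"
proof -
  have nn: "l1_norm u \<ge> 0" for u :: "real ^ 'n" by (simp add: l1_norm_def sum_nonneg)
  have "(\<Sum>i\<in>N. l1_norm (row i A) * \<bar>v $ i\<bar>) \<le> (\<Sum>i\<in>UNIV. l1_norm (row i A) * \<bar>v $ i\<bar>)"
    using nn by (intro sum_mono2) auto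
  also have "\<dots> \<le> L2_set (\<lambda>i. l1_norm (row i A)) UNIV * L2_set (($) v) UNIV"
    using L2_set_mult_ineq[of "\<lambda>i. l1_norm (row i A)" "($) v" UNIV] nn by simp
  also have "\<dots> = norm v * norm_1_2 A"
    by (simp add: L2_set_def norm_1_2_def norm_vec_def)
  finally show ?thesis .
qed

lemma exact_step_contraction:
  fixes A :: "real ^ 'n ^ 'm" and b :: "real ^ 'm" and y z :: "real ^ 'n"
    and lam :: real
  defines "D \<equiv> \<lambda>z. bregman_dist (objective lam) z (soft_shrinkage lam z) y"
  assumes lam: "lam \<ge> 0" and unit: "\<And>i. norm (row i A) = 1" and y: "y \<noteq> 0"
    and B: "real (card {i. b $ i \<noteq> row i A \<bullet> y}) = \<beta> * real CARD('m)"
    and q: "0 < q" "\<beta> \<le> q" "q < 1 - \<beta>"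
    and adm: "admissible_sample_set q A b (soft_shrinkage lam z) N"
    and t: "\<And>i. i \<in> N \<Longrightarrow> exact_step lam A b z i (t i)"
    and C: "C = (q - \<beta>) / (2 * q\<^sup>2 * real CARD('m)) * (abs_min y / (abs_min y + 2 * lam))
               * (sigma_tilde_min (q - \<beta>) A)\<^sup>2
             - 1 / (q * real CARD('m))
               * (2 * sqrt \<beta> / sqrt (1 - q - \<beta>) + \<beta> / (1 - q - \<beta>)) * (sigma_max A)\<^sup>2"
  shows "(\<Sum>i\<in>N. D (z - t i *\<^sub>R row i A))
         \<le> q * real CARD('m) * ((1 - C) * D z) + 2 * lam * (norm (b - A *v y) * norm_1_2 A)"
proof -
  \<comment> \<open>A hypothetical inexact step from the same \<open>z\<close> for each index. The
    comparison is made within one step, never between two trajectories.\<close>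
  define s where "s i = row i A \<bullet> soft_shrinkage lam z - b $ i" for i
  have s: "inexact_step lam A b z i (s i)" for i by (simp add: inexact_step_def s_def)
  have "(\<Sum>i\<in>N. D (z - t i *\<^sub>R row i A))
        \<le> (\<Sum>i\<in>N. D (z - s i *\<^sub>R row i A)
              + 2 * lam * (l1_norm (row i A) * \<bar>b $ i - row i A \<bullet> y\<bar>))"
    unfolding D_def by (intro sum_mono bregman_exact_le_inexact[OF lam unit t s])
  also have "\<dots> = (\<Sum>i\<in>N. D (z - s i *\<^sub>R row i A))
              + 2 * lam * (\<Sum>i\<in>N. l1_norm (row i A) * \<bar>(b - A *v y) $ i\<bar>)"
    by (simp add: sum.distrib sum_distrib_left matrix_vector_mul_component row_def)
  also have "\<dots> \<le> q * real CARD('m) * ((1 - C) * D z)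
                  + 2 * lam * (norm (b - A *v y) * norm_1_2 A)"
    unfolding D_def
    by (intro add_mono mult_left_mono sum_l1_norm_rows_le
        inexact_step_contraction[OF lam unit y B q adm s C]) (use lam in auto)
  finally show ?thesis .
qed

section \<open>Expectations over the index history\<close>

lemma length_history: "length (history idx k \<omega>) = k"
  by (induction k) auto

lemma finite_lists_of_length: "finite {h :: 'm::finite list. length h = k}"
  using finite_lists_length_eq[of "UNIV :: 'm set" k] by simp

lemma history_event_measurable:
  fixes idx :: "nat \<Rightarrow> 'w \<Rightarrow> 'm"
  assumes "\<And>k. idx k \<in> measurable M (count_space UNIV)"
  shows "{\<omega> \<in> space M. history idx k \<omega> = h} \<in> sets M"
proof (induction k arbitrary: h)
  case (Suc k)
  show ?case
  proof (cases h)
    case (Cons i h')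
    have "{\<omega> \<in> space M. history idx (Suc k) \<omega> = h}
          = (idx k -` {i} \<inter> space M) \<inter> {\<omega> \<in> space M. history idx k \<omega> = h'}"
      by (auto simp: Cons)
    then show ?thesis using Suc measurable_sets[OF assms, of "{i}" k] by auto
  qed simp
qed simp

text \<open>There are finitely many histories of length \<open>k\<close>, so the integrand is a
  finite combination of indicators of history events.\<close>

lemma (in prob_space) expectation_history:
  fixes idx :: "nat \<Rightarrow> 'a \<Rightarrow> 'm::finite" and F :: "'m list \<Rightarrow> real"
  assumes "\<And>k. idx k \<in> measurable M (count_space UNIV)"
  shows "expectation (\<lambda>\<omega>. F (history idx k \<omega>))
         = (\<Sum>h | length h = k. prob {\<omega> \<in> space M. history idx k \<omega> = h} * F h)"
proof -
  have "F (history idx k \<omega>)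
        = (\<Sum>h | length h = k. indicator {\<omega> \<in> space M. history idx k \<omega> = h} \<omega> * F h)"
    if "\<omega> \<in> space M" for \<omega>
  proof -
    have "(\<Sum>h | length h = k. indicator {\<omega> \<in> space M. history idx k \<omega> = h} \<omega> * F h)
          = (\<Sum>h | length h = k. if h = history idx k \<omega> then F h else 0)"
      using that by (intro sum.cong) (auto simp: indicator_def)
    then show ?thesis by (simp add: finite_lists_of_length length_history)
  qed
  then have "expectation (\<lambda>\<omega>. F (history idx k \<omega>))
        = expectation (\<lambda>\<omega>. \<Sum>h | length h = k.
            indicator {\<omega> \<in> space M. history idx k \<omega> = h} \<omega> * F h)"
    by (intro Bochner_Integration.integral_cong) auto
  also have "\<dots> = (\<Sum>h | length h = k. expectation (\<lambda>\<omega>.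
            indicator {\<omega> \<in> space M. history idx k \<omega> = h} \<omega> * F h))"
    by (intro Bochner_Integration.integral_sum integrable_mult_left integrable_real_indicator
        history_event_measurable assms)
       (simp add: emeasure_eq_measure)
  also have "\<dots> = (\<Sum>h | length h = k. prob {\<omega> \<in> space M. history idx k \<omega> = h} * F h)"
    by (simp add: Collect_conj_eq Int_absorb2 Int_commute[of "space M"])
  finally show ?thesis .
qed

text \<open>Lifts a one-step inequality valid after every history to expectations: conditionally on
  \<open>h\<close>, the expected next value is the average of \<open>F (i # h)\<close> over
  \<open>N h\<close>.\<close>

lemma expected_distance_recursion:
  fixes A :: "real ^ 'n ^ 'm" and xhat :: "real ^ 'n" and t :: "'m list \<Rightarrow> real"
    and lam :: real
  defines "F \<equiv> \<lambda>h. bregman_dist (objective lam) (dual_iterate A t h) (primal_iterate lam A t h) xhat"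
  assumes rask: "quantile_rask step lam q A b M idx N t" and "q > 0"
    and descent: "\<And>h. (\<Sum>i\<in>N h. F (i # h)) \<le> q * real CARD('m) * (\<rho> * F h + c)"
  shows "expected_distance lam A xhat M idx t (Suc k)
         \<le> \<rho> * expected_distance lam A xhat M idx t k + c"
proof -
  interpret prob_space M using rask by (simp add: quantile_rask_def)
  have idx: "\<And>k. idx k \<in> measurable M (count_space UNIV)"
    using rask by (simp add: quantile_rask_def)
  have uniform: "prob {\<omega> \<in> space M. history idx k \<omega> = h \<and> idx k \<omega> = i}
      = (if i \<in> N h then 1 / (q * real CARD('m)) else 0) * prob {\<omega> \<in> space M. history idx k \<omega> = h}"
    for h i
    using rask by (simp add: quantile_rask_def)
  define P where "P h = prob {\<omega> \<in> space M. history idx k \<omega> = h}" for h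
  have E: "expected_distance lam A xhat M idx t j
      = (\<Sum>h | length h = j. prob {\<omega> \<in> space M. history idx j \<omega> = h} * F h)" for j
    using expectation_history[OF idx, where F = F and k = j] by (simp add: expected_distance_def F_def)
  have qm: "q * real CARD('m) > 0" using \<open>q > 0\<close> by simp
  have lists: "{h :: 'm list. length h = Suc k} = (\<lambda>(h, i). i # h) ` ({h. length h = k} \<times> UNIV)"
    by (auto simp: length_Suc_conv image_iff)
  have "expected_distance lam A xhat M idx t (Suc k)
        = (\<Sum>(h, i)\<in>{h. length h = k} \<times> UNIV.
             prob {\<omega> \<in> space M. history idx (Suc k) \<omega> = i # h} * F (i # h))"
    unfolding E lists by (subst sum.reindex) (auto simp: inj_on_def case_prod_unfold)
  also have "\<dots> = (\<Sum>h | length h = k. \<Sum>i\<in>UNIV.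
        prob {\<omega> \<in> space M. history idx k \<omega> = h \<and> idx k \<omega> = i} * F (i # h))"
    by (subst sum.cartesian_product[symmetric]) (simp add: conj_commute)
  also have "\<dots> = (\<Sum>h | length h = k. P h * ((\<Sum>i\<in>N h. F (i # h)) / (q * real CARD('m))))"
  proof (rule sum.cong[OF refl])
    fix h
    have "(\<Sum>i\<in>UNIV. prob {\<omega> \<in> space M. history idx k \<omega> = h \<and> idx k \<omega> = i} * F (i # h))
          = (\<Sum>i\<in>UNIV. if i \<in> N h then P h * (F (i # h) / (q * real CARD('m))) else 0)"
      unfolding uniform P_def by (intro sum.cong) auto
    also have "\<dots> = (\<Sum>i\<in>N h. P h * (F (i # h) / (q * real CARD('m))))"
      by (simp add: sum.If_cases)
    finally show "(\<Sum>i\<in>UNIV. prob {\<omega> \<in> space M. history idx k \<omega> = h \<and> idx k \<omega> = i} * F (i # h))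
          = P h * ((\<Sum>i\<in>N h. F (i # h)) / (q * real CARD('m)))"
      by (simp add: sum_distrib_left sum_divide_distrib)
  qed
  also have "\<dots> \<le> (\<Sum>h | length h = k. P h * (\<rho> * F h + c))"
    using descent qm
    by (intro sum_mono mult_left_mono) (auto simp: P_def pos_divide_le_eq mult.commute)
  also have "\<dots> = \<rho> * (\<Sum>h | length h = k. P h * F h) + c * (\<Sum>h | length h = k. P h)"
    by (simp add: sum.distrib sum_distrib_left algebra_simps)
  \<comment> \<open>The expectation formula for the constant function 1, so that \<open>c\<close>
    enters with weight one.\<close>
  also have "(\<Sum>h | length h = k. P h) = 1"
    using expectation_history[OF idx, where F = "\<lambda>_. 1" and k = k] by (simp add: P_def prob_space)
  finally show ?thesis unfolding E[of k] P_def by simp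
qed

section \<open>Positivity of the rate and assembly of both recursions\<close>

theorem theorem2:
  fixes A :: "real ^ 'n ^ 'm" and xhat :: "real ^ 'n" and btilde bc b :: "real ^ 'm"
    and lam \<beta> q C :: real
  assumes "rank A = min CARD('m) CARD('n)"
    and "\<And>i. norm (row i A) = 1"
    and "xhat \<noteq> 0"
    and "btilde = A *v xhat"
    and "b = btilde + bc"
    and "real (l0_norm bc) = \<beta> * real CARD('m)"
    and "q * real CARD('m) \<in> \<int>"
    and "lam > 0"
    and "\<beta> < q" and "q < 1 - \<beta>"
    and "2 * q / (q - \<beta>) * (2 * sqrt \<beta> / sqrt (1 - q - \<beta>) + \<beta> / (1 - q - \<beta>))
           * ((abs_min xhat + 2 * lam) / abs_min xhat)
         < (sigma_tilde_min (q - \<beta>) A)\<^sup>2 / (sigma_max A)\<^sup>2"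
    and "C = (q - \<beta>) / (2 * q\<^sup>2 * real CARD('m)) * (abs_min xhat / (abs_min xhat + 2 * lam))
               * (sigma_tilde_min (q - \<beta>) A)\<^sup>2
             - 1 / (q * real CARD('m))
               * (2 * sqrt \<beta> / sqrt (1 - q - \<beta>) + \<beta> / (1 - q - \<beta>)) * (sigma_max A)\<^sup>2"
  shows "C > 0 \<and>
    (\<forall>(M :: 'w measure) idx N t. quantile_rask inexact_step lam q A b M idx N t \<longrightarrow>
       (\<forall>k. expected_distance lam A xhat M idx t (Suc k)
              \<le> (1 - C) * expected_distance lam A xhat M idx t k)) \<and>
    (\<forall>(M :: 'w measure) idx N t. quantile_rask exact_step lam q A b M idx N t \<longrightarrow>
       (\<forall>k. expected_distance lam A xhat M idx t (Suc k)
              \<le> (1 - C) * expected_distance lam A xhat M idx t k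
                + 2 * lam / (q * real CARD('m)) * norm (b - btilde) * norm_1_2 A))"
proof -
  define m where "m = real CARD('m)"
  have m: "m > 0" by (simp add: m_def)
  have "0 \<le> \<beta> * m" using assms(6) unfolding m_def by (metis of_nat_0_le_iff)
  then have \<beta>: "0 \<le> \<beta>" using m by (simp add: zero_le_mult_iff)
  have q: "0 < q" using \<beta> assms(9) by simp
  have lam: "0 \<le> lam" using assms(8) by simp
  \<comment> \<open>A row is corrupted exactly when its index lies in the support of
    \<open>bc\<close>.\<close>
  have B: "real (card {i. b $ i \<noteq> row i A \<bullet> xhat}) = \<beta> * real CARD('m)"
    using assms(6) by (simp add: assms(4,5) l0_norm_def matrix_vector_mul_component row_def)

  have "C > 0"
  proof -
    define K where "K = 2 * sqrt \<beta> / sqrt (1 - q - \<beta>) + \<beta> / (1 - q - \<beta>)"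
    define S where "S = (sigma_tilde_min (q - \<beta>) A)\<^sup>2"
    define T where "T = (sigma_max A)\<^sup>2"
    define u where "u = abs_min xhat"
    have u: "u > 0" unfolding u_def by (rule abs_min_pos) fact
    have K: "0 \<le> K" unfolding K_def using \<beta> assms(10) by simp
    have hyp: "2 * q / (q - \<beta>) * K * ((u + 2 * lam) / u) < S / T"
      using assms(11) by (simp add: K_def S_def T_def u_def)
    \<comment> \<open>A zero \<open>T\<close> would make the quotient \<open>S / T\<close> zero,
      contradicting that it exceeds this nonnegative quantity.\<close>
    have "0 \<le> 2 * q / (q - \<beta>) * K * ((u + 2 * lam) / u)"
      using K u q lam assms(9) by (intro mult_nonneg_nonneg divide_nonneg_nonneg) auto
    with hyp have "0 < S / T" by linarith
    then have T: "T > 0" by (auto simp: T_def zero_less_divide_iff)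
    \<comment> \<open>Chosen to cancel the factors around \<open>K\<close> on the left of the
      hypothesis.\<close>
    define v where "v = (q - \<beta>) / (2 * q) * (u / (u + 2 * lam))"
    have v: "v > 0" unfolding v_def using assms(9) q u lam by (intro mult_pos_pos divide_pos_pos) auto
    have "v * (2 * q / (q - \<beta>) * K * ((u + 2 * lam) / u)) < v * (S / T)"
      using hyp v by (rule mult_strict_left_mono)
    moreover have "v * (2 * q / (q - \<beta>) * K * ((u + 2 * lam) / u)) = K"
    proof -
      have "q - \<beta> \<noteq> 0" "u + 2 * lam \<noteq> 0" using assms(9) u lam by auto
      then show ?thesis unfolding v_def using q u by simp
    qed
    ultimately have "K < v * S / T" by simp
    then have "K * T < v * S" using T by (simp only: pos_less_divide_eq)
    then have "0 < (v * S - K * T) / (q * m)" using q m by simp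
    also have "\<dots> = C"
    proof -
      define g where "g = u / (u + 2 * lam)"
      show ?thesis
        unfolding assms(12) v_def m_def[symmetric] u_def[symmetric] S_def[symmetric]
          T_def[symmetric] K_def[symmetric] g_def[symmetric]
        using q m by (simp add: field_simps power2_eq_square)
    qed
    finally show ?thesis .
  qed
  moreover have "expected_distance lam A xhat M idx t (Suc k)
      \<le> (1 - C) * expected_distance lam A xhat M idx t k"
    if rask: "quantile_rask inexact_step lam q A b M idx N t"
    for M :: "'w measure" and idx N t k
  proof -
    have adm: "admissible_sample_set q A b (soft_shrinkage lam (dual_iterate A t h)) (N h)"
      and step: "\<And>i. i \<in> N h \<Longrightarrow> inexact_step lam A b (dual_iterate A t h) i (t (i # h))" for h
      using rask by (simp_all add: quantile_rask_def primal_iterate_def)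
    have "expected_distance lam A xhat M idx t (Suc k)
        \<le> (1 - C) * expected_distance lam A xhat M idx t k + 0"
      by (rule expected_distance_recursion[OF rask q])
         (use inexact_step_contraction[OF lam assms(2,3) B q less_imp_le[OF assms(9)] assms(10)
            adm step assms(12)] in \<open>simp add: primal_iterate_def\<close>)
    then show ?thesis by simp
  qed
  moreover have "expected_distance lam A xhat M idx t (Suc k)
      \<le> (1 - C) * expected_distance lam A xhat M idx t k
         + 2 * lam / (q * real CARD('m)) * norm (b - btilde) * norm_1_2 A"
    if rask: "quantile_rask exact_step lam q A b M idx N t"
    for M :: "'w measure" and idx N t k
  proof -
    have adm: "admissible_sample_set q A b (soft_shrinkage lam (dual_iterate A t h)) (N h)"
      and step: "\<And>i. i \<in> N h \<Longrightarrow> exact_step lam A b (dual_iterate A t h) i (t (i # h))" for h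
      using rask by (simp_all add: quantile_rask_def primal_iterate_def)
    \<comment> \<open>The error summed over the sample set is \<open>q * real CARD('m)\<close> times
      the additive term of the claim, because the recursion averages over that many indices.\<close>
    have "q * real CARD('m) \<noteq> 0" using q by simp
    then have c: "q * real CARD('m) * (r + 2 * lam / (q * real CARD('m)) * norm (b - btilde) * norm_1_2 A)
        = q * real CARD('m) * r + 2 * lam * (norm (b - A *v xhat) * norm_1_2 A)" for r
      unfolding assms(4) distrib_left by simp
    show ?thesis
    proof (rule expected_distance_recursion[OF rask q])
      fix h
      show "(\<Sum>i\<in>N h. bregman_dist (objective lam) (dual_iterate A t (i # h))
               (primal_iterate lam A t (i # h)) xhat)
        \<le> q * real CARD('m) * ((1 - C) * bregman_dist (objective lam) (dual_iterate A t h)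
               (primal_iterate lam A t h) xhat
             + 2 * lam / (q * real CARD('m)) * norm (b - btilde) * norm_1_2 A)"
        unfolding c
        using exact_step_contraction[OF lam assms(2,3) B q less_imp_le[OF assms(9)] assms(10)
            adm step assms(12)] by (simp add: primal_iterate_def)
    qed
  qed
  ultimately show ?thesis by blast
qed

end
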